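(* Let $\ell$ be a positive integer. If $G$ is a finite simple graph with $\mathrm{lcc}(G)\le \ell$, then $\chi_{\mathrm{o}}(G)\le \frac{2\ell-1}{\ell}\Delta(G)+2$.
   Context: The local vertex clique cover number $\mathrm{lcc}(G)$ of a graph $G$ is the minimum $q$ such that for every vertex $v$, the neighborhood $N_G(v)$ is the union of at most $q$ cliques. An odd $k$-coloring of $G$ is a proper $k$-coloring (adjacent vertices get different colors from $\{1,\dots,k\}$) such that every vertex of positive degree has some color appearing an odd number of times on its neighborhood. The odd chromatic number $\chi_{\mathrm{o}}(G)$ is the minimum $k$ for which $G$ has an odd $k$-coloring. $\Delta(G)$ is the maximum degree. *)

theory Defs
  imports Complex_Main "Graph_Theory.Digraph"
begin

text \<open>Finite simple graphs are given by the locale \<^locale>\<open>graph\<close>: finite, loop-free digraphs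
  without multiple arcs whose adjacency relation is symmetric.  Thus every edge is a pair of
  opposite arcs, and \<^const>\<open>out_degree\<close> is the degree of the undirected graph.\<close>

definition neighborhood :: "('a, 'b) pre_digraph \<Rightarrow> 'a \<Rightarrow> 'a set" where
  "neighborhood G v = {u \<in> verts G. v \<rightarrow>\<^bsub>G\<^esub> u}"

text \<open>Inserting 0 only serves to give the graph without vertices maximum degree 0.\<close>

definition max_degree :: "('a, 'b) pre_digraph \<Rightarrow> nat" where
  "max_degree G = Max (insert 0 (out_degree G ` verts G))"

definition is_clique :: "('a, 'b) pre_digraph \<Rightarrow> 'a set \<Rightarrow> bool" where
  "is_clique G K \<longleftrightarrow> K \<subseteq> verts G \<and> (\<forall>u\<in>K. \<forall>w\<in>K. u \<noteq> w \<longrightarrow> u \<rightarrow>\<^bsub>G\<^esub> w)"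

definition locally_clique_covered :: "('a, 'b) pre_digraph \<Rightarrow> nat \<Rightarrow> bool" where
  "locally_clique_covered G q \<longleftrightarrow>
     (\<forall>v\<in>verts G. \<exists>\<K>. finite \<K> \<and> card \<K> \<le> q \<and> (\<forall>K\<in>\<K>. is_clique G K) \<and>
        neighborhood G v = \<Union>\<K>)"

definition lcc :: "('a, 'b) pre_digraph \<Rightarrow> nat" where
  "lcc G = (LEAST q. locally_clique_covered G q)"

definition odd_coloring :: "('a, 'b) pre_digraph \<Rightarrow> nat \<Rightarrow> ('a \<Rightarrow> nat) \<Rightarrow> bool" where
  "odd_coloring G k c \<longleftrightarrow>
     (\<forall>v\<in>verts G. c v \<in> {1..k}) \<and>
     (\<forall>u\<in>verts G. \<forall>v\<in>verts G. u \<rightarrow>\<^bsub>G\<^esub> v \<longrightarrow> c u \<noteq> c v) \<and>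
     (\<forall>v\<in>verts G. out_degree G v > 0 \<longrightarrow>
        (\<exists>i\<in>{1..k}. odd (card {u \<in> neighborhood G v. c u = i})))"

definition odd_chromatic_number :: "('a, 'b) pre_digraph \<Rightarrow> nat" where
  "odd_chromatic_number G = (LEAST k. \<exists>c. odd_coloring G k c)"

text \<open>On finite simple graphs both minima range over nonempty sets, and the degree counts
  neighbors.\<close>

lemma (in graph) degree_eq_card_neighborhood: "out_degree G v = card (neighborhood G v)"
proof -
  have "neighborhood G v = head G ` out_arcs G v"
    by (auto simp: neighborhood_def arcs_ends_conv)
  moreover have "inj_on (head G) (out_arcs G v)"
    by (rule inj_onI, rule no_multi_arcs) (simp_all add: arc_to_ends_def)
  ultimately show ?thesis
    by (simp add: out_degree_def card_image)
qed

lemma (in graph) locally_clique_covered_lcc: "locally_clique_covered G (lcc G)"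
proof -
  have "locally_clique_covered G (card (verts G))"
    unfolding locally_clique_covered_def
  proof
    fix v
    let ?C = "(\<lambda>u. {u}) ` neighborhood G v"
    have fin: "finite (neighborhood G v)" and sub: "neighborhood G v \<subseteq> verts G"
      by (auto simp: neighborhood_def)
    have "card ?C \<le> card (verts G)"
      using card_image_le[OF fin] card_mono[OF finite_verts sub] by (rule le_trans)
    then show "\<exists>\<K>. finite \<K> \<and> card \<K> \<le> card (verts G) \<and> (\<forall>K\<in>\<K>. is_clique G K) \<and>
        neighborhood G v = \<Union>\<K>"
      using fin sub by (intro exI[of _ ?C]) (auto simp: is_clique_def)
  qed
  then show ?thesis unfolding lcc_def by (rule LeastI)
qed

lemma (in graph) odd_coloring_odd_chromatic_number: "\<exists>c. odd_coloring G (odd_chromatic_number G) c"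
proof -
  obtain c where c: "bij_betw c (verts G) {1..card (verts G)}"
    using finite_same_card_bij[of "verts G" "{1..card (verts G)}"] by auto
  have "odd_coloring G (card (verts G)) c"
    unfolding odd_coloring_def
  proof (intro conjI ballI impI)
    fix v assume "v \<in> verts G"
    then show "c v \<in> {1..card (verts G)}" using c by (auto simp: bij_betw_def)
  next
    fix u v assume "u \<in> verts G" "v \<in> verts G" "u \<rightarrow> v"
    then show "c u \<noteq> c v"
      using c adj_not_same by (metis bij_betw_imp_inj_on inj_onD)
  next
    fix v assume "0 < out_degree G v"
    then obtain u where u: "u \<in> neighborhood G v"
      by (auto simp: degree_eq_card_neighborhood card_gt_0_iff)
    then have "{w \<in> neighborhood G v. c w = c u} = {u}"
      using c by (auto dest: inj_onD simp: bij_betw_def neighborhood_def)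
    moreover have "c u \<in> {1..card (verts G)}"
      using u c by (auto simp: bij_betw_def neighborhood_def)
    ultimately show "\<exists>i\<in>{1..card (verts G)}. odd (card {w \<in> neighborhood G v. c w = i})"
      by (intro bexI[of _ "c u"]) auto
  qed
  then show ?thesis unfolding odd_chromatic_number_def
    using LeastI[of "\<lambda>k. \<exists>c. odd_coloring G k c"] by blast
qed

end

theory Submission
  imports Defs
begin

text \<open>Induct on the vertex set. Let \<open>v\<close> have maximum degree \<open>\<Delta>\<close>, let \<open>K\<close> be the largest clique of a
  cover of its neighborhood, and color everything outside the clique \<open>Q = K \<union> {v}\<close>, where
  \<open>|Q| \<ge> \<Delta> / l + 1\<close>. Each outer neighbor \<open>u\<close> of \<open>q \<in> Q\<close> forbids at most two colors at \<open>q\<close>: its own,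
  and one color that is odd at \<open>u\<close>. This leaves at least \<open>|Q| + 1\<close> colors per vertex of \<open>Q\<close>.
  An injective choice \<open>c\<close> from these lists can fail only at some \<open>q \<in> Q\<close> for which
  \<open>c ` (Q - {q})\<close> is exactly the set of colors that are odd on the outer neighborhood of \<open>q\<close>. That
  set is disjoint from the list of \<open>q\<close>, and this leaves room to recolor two vertices of \<open>Q\<close>.\<close>

section \<open>Injective choices from lists of colors\<close>

lemma injective_choice_exists:
  assumes "finite Q" and "\<And>q. q \<in> Q \<Longrightarrow> card Q \<le> card (L q)"
  obtains c where "inj_on c Q" and "\<And>q. q \<in> Q \<Longrightarrow> c q \<in> L q"
proof -
  have "\<exists>c. inj_on c Q \<and> (\<forall>q\<in>Q. c q \<in> L q)"
    using assms
  proof (induction Q rule: finite_induct)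
    case empty
    show ?case by simp
  next
    case (insert x Q)
    have "card Q \<le> card (L q)" if "q \<in> Q" for q
      using insert.prems[of q] insert.hyps that by simp
    then obtain c where c: "inj_on c Q" "\<forall>q\<in>Q. c q \<in> L q"
      using insert.IH by blast
    have "card (c ` Q) < card (L x)"
      using insert.prems[of x] insert.hyps card_image_le[of Q c] by simp
    then obtain y where y: "y \<in> L x" "y \<notin> c ` Q"
      by (meson card_mono finite_imageI insert.hyps(1) leD subsetI)
    have "inj_on (c(x := y)) (insert x Q)"
      using c y insert.hyps by (auto simp: inj_on_def)
    moreover have "\<forall>q\<in>insert x Q. (c(x := y)) q \<in> L q"
      using c y by auto
    ultimately show ?case by blast
  qed
  then show ?thesis using that by blast
qed

text \<open>In the application \<open>P q\<close> is the set of colors odd on the outer neighbors of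
  \<open>q\<close>; parities at \<open>q\<close> cancel completely only when the rest of
  \<open>Q\<close> receives exactly the set \<open>P q\<close>.\<close>

lemma injective_choice_avoiding:
  assumes fin: "finite Q" and two: "2 \<le> card Q"
    and L: "\<And>q. q \<in> Q \<Longrightarrow> card Q < card (L q)"
    and disj: "\<And>q. q \<in> Q \<Longrightarrow> P q \<inter> L q = {}"
  obtains c where "inj_on c Q" and "\<And>q. q \<in> Q \<Longrightarrow> c q \<in> L q"
    and "\<And>q. q \<in> Q \<Longrightarrow> c ` (Q - {q}) \<noteq> P q"
proof -
  obtain c where c: "inj_on c Q" "\<And>q. q \<in> Q \<Longrightarrow> c q \<in> L q"
    using injective_choice_exists[of Q L] fin L by (metis less_imp_le)
  show ?thesis
  proof (cases "\<forall>q\<in>Q. c ` (Q - {q}) \<noteq> P q")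
    case True
    then show ?thesis using that c by blast
  next
    case False
    then obtain j where j: "j \<in> Q" "P j = c ` (Q - {j})" by auto
    have "Q \<noteq> {j}" using two by auto
    then obtain i where i: "i \<in> Q" "i \<noteq> j" using j by auto
    have "card (P j) \<le> card Q"
      using j(2) card_image_le[of "Q - {j}" c] card_mono[of Q "Q - {j}"] fin by auto
    then have "card (P j) < card (L i)" using L[OF i(1)] by simp
    moreover have "finite (P j)" using j fin by simp
    ultimately obtain y where y: "y \<in> L i" "y \<notin> P j"
      by (meson card_mono leD subsetI)
    \<comment> \<open>Recoloring \<open>i\<close> by \<open>y\<close> repairs \<open>j\<close> whatever the color of \<open>j\<close>, which may then be any color of
      \<open>L j - {y}\<close>; every other \<open>t \<in> Q\<close> rules out at most one of these (the set \<open>Z t\<close>).\<close>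
    define d where "d = c(i := y)"
    \<comment> \<open>\<open>P j\<close> holds precisely the colors of \<open>Q - {j}\<close>, so
      \<open>y\<close> is new among them. The vertex \<open>j\<close> is left out because its own
      color may equal \<open>y\<close>.\<close>
    have d_inj: "inj_on d (Q - {j})"
      using c(1) y(2) j(2) by (auto simp: d_def inj_on_def)
    have d_im: "d ` (Q - {j}) \<subseteq> insert y (P j)"
      using j(2) by (auto simp: d_def)
    define Z where "Z t = {z. z \<notin> d ` (Q - {j}) \<and> P t = insert z (d ` (Q - {j, t}))}" for t
    have Z: "finite (Z t) \<and> card (Z t) \<le> 1" if "t \<in> Q" for t
    proof -
      \<comment> \<open>Such a \<open>z\<close> is the one element of \<open>P t\<close> missing
        from the image of \<open>Q - {j, t}\<close> under \<open>d\<close>.\<close>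
      have "Z t \<subseteq> {z}" if "z \<in> Z t" for z
      proof
        fix z' assume "z' \<in> Z t"
        then have z': "insert z' (d ` (Q - {j, t})) = insert z (d ` (Q - {j, t}))"
          "z' \<notin> d ` (Q - {j, t})"
          using \<open>z \<in> Z t\<close> by (auto simp: Z_def)
        then show "z' \<in> {z}" by blast
      qed
      then have "Z t = {} \<or> (\<exists>z. Z t = {z})" by blast
      then show ?thesis by auto
    qed
    have "card (\<Union>t\<in>Q - {j}. Z t) \<le> (\<Sum>t\<in>Q - {j}. card (Z t))"
      using fin by (intro card_UN_le) simp
    also have "\<dots> \<le> (\<Sum>t\<in>Q - {j}. 1)"
      using Z by (intro sum_mono) blast
    also have "\<dots> = card Q - 1" using fin j by simp
    finally have UZ: "card (\<Union>t\<in>Q - {j}. Z t) \<le> card Q - 1" .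
    \<comment> \<open>The extra color in each list pays for \<open>y\<close>: at least
      \<open>card Q\<close> candidates remain against at most \<open>card Q - 1\<close>
      exclusions.\<close>
    have "card Q \<le> card (L j - {y})"
      using L[OF j(1)] by (auto simp: card_Diff_singleton_if)
    then have "card (\<Union>t\<in>Q - {j}. Z t) < card (L j - {y})" using UZ two by simp
    moreover have "finite (\<Union>t\<in>Q - {j}. Z t)" using fin Z by auto
    ultimately have "\<not> L j - {y} \<subseteq> (\<Union>t\<in>Q - {j}. Z t)" by (meson card_mono leD)
    then obtain z where z: "z \<in> L j" "z \<noteq> y" "\<And>t. t \<in> Q - {j} \<Longrightarrow> z \<notin> Z t"
      by blast
    \<comment> \<open>Disjointness of \<open>P j\<close> and \<open>L j\<close> enters here:
      \<open>z\<close> is not in \<open>P j\<close>, and it differs from \<open>y\<close>.\<close>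
    have z_new: "z \<notin> d ` (Q - {j})" using z d_im disj[OF j(1)] by blast
    define e where "e = d(j := z)"
    have e_d: "e ` A = d ` A" if "j \<notin> A" for A using that by (auto simp: e_def)
    show ?thesis
    proof
      have "inj_on e (insert j (Q - {j}))"
        using d_inj z_new by (subst inj_on_insert) (auto simp: e_def inj_on_def)
      then show "inj_on e Q" using j(1) by (simp add: insert_absorb)
    next
      fix q assume q: "q \<in> Q"
      then show "e q \<in> L q" using c(2) y z i by (auto simp: e_def d_def)
      show "e ` (Q - {q}) \<noteq> P q"
      proof (cases "q = j")
        case True
        have "e i \<in> e ` (Q - {j})" using i by blast
        moreover have "e i = y" using i by (simp add: e_def d_def)
        ultimately show ?thesis using y True by auto
      next
        case False
        have "Q - {q} = insert j (Q - {j, q})" using j(1) False by auto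
        then have "e ` (Q - {q}) = insert (e j) (e ` (Q - {j, q}))" by (metis image_insert)
        then have "e ` (Q - {q}) = insert z (d ` (Q - {j, q}))"
          using e_d[of "Q - {j, q}"] by (simp add: e_def)
        then show ?thesis using z(3)[of q] z_new False q by (auto simp: Z_def)
      qed
    qed
  qed
qed

section \<open>Colors of odd multiplicity\<close>

definition odd_colors :: "('a \<Rightarrow> 'c) \<Rightarrow> 'a set \<Rightarrow> 'c set" where
  "odd_colors c A = {i. odd (card {u \<in> A. c u = i})}"

lemma odd_colors_subset: "odd_colors c A \<subseteq> c ` A"
proof
  fix i assume "i \<in> odd_colors c A"
  then have "{u \<in> A. c u = i} \<noteq> {}" unfolding odd_colors_def by force
  then show "i \<in> c ` A" by blast
qed

lemma odd_colors_cong: "(\<And>u. u \<in> A \<Longrightarrow> c u = d u) \<Longrightarrow> odd_colors c A = odd_colors d A"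
  unfolding odd_colors_def by (simp cong: conj_cong)

text \<open>Color counts add over a disjoint union, so the odd sets combine by symmetric difference;
  the result is empty only if both sets agree.\<close>

lemma odd_colors_Un:
  assumes "finite A" "finite B" "A \<inter> B = {}"
  shows "i \<in> odd_colors c (A \<union> B) \<longleftrightarrow> (i \<in> odd_colors c A) \<noteq> (i \<in> odd_colors c B)"
proof -
  have "{u \<in> A \<union> B. c u = i} = {u \<in> A. c u = i} \<union> {u \<in> B. c u = i}" by auto
  moreover have "card ({u \<in> A. c u = i} \<union> {u \<in> B. c u = i}) =
      card {u \<in> A. c u = i} + card {u \<in> B. c u = i}"
    using assms by (intro card_Un_disjoint) auto
  ultimately show ?thesis by (auto simp: odd_colors_def)
qed

lemma odd_colors_inj_on:
  assumes "inj_on c A"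
  shows "odd_colors c A = c ` A"
proof
  show "c ` A \<subseteq> odd_colors c A"
  proof
    fix i assume "i \<in> c ` A"
    then obtain u where "u \<in> A" "i = c u" by blast
    then have "{w \<in> A. c w = i} = {u}" using assms by (auto dest: inj_onD)
    then show "i \<in> odd_colors c A" by (simp add: odd_colors_def)
  qed
qed (rule odd_colors_subset)

text \<open>Cutting neighborhoods down to \<open>S\<close> encodes the subgraph induced by
  \<open>S\<close>, so the induction can run over vertex sets of one fixed graph.\<close>

definition odd_coloring_on :: "('a, 'b) pre_digraph \<Rightarrow> nat \<Rightarrow> 'a set \<Rightarrow> ('a \<Rightarrow> nat) \<Rightarrow> bool" where
  "odd_coloring_on G k S c \<longleftrightarrow>
     c ` S \<subseteq> {1..k} \<and>
     (\<forall>v\<in>S. \<forall>u\<in>neighborhood G v \<inter> S. c u \<noteq> c v) \<and>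
     (\<forall>v\<in>S. neighborhood G v \<inter> S \<noteq> {} \<longrightarrow> odd_colors c (neighborhood G v \<inter> S) \<noteq> {})"

section \<open>Extending an odd coloring over a clique\<close>

context graph
begin

lemma finite_neighborhood: "finite (neighborhood G v)"
  by (simp add: neighborhood_def)

lemma neighborhood_sym: "u \<in> neighborhood G v \<Longrightarrow> v \<in> neighborhood G u"
  using sym_arcs adj_in_verts by (auto simp: neighborhood_def symmetric_def dest: symD)

lemma not_in_neighborhood_self: "v \<notin> neighborhood G v"
  using adj_not_same by (auto simp: neighborhood_def)

lemma odd_coloring_if_odd_coloring_on:
  assumes "odd_coloring_on G k (verts G) c"
  shows "odd_coloring G k c"
proof -
  have N: "neighborhood G v \<inter> verts G = neighborhood G v" for v
    by (auto simp: neighborhood_def)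
  note a = assms[unfolded odd_coloring_on_def N]
  show ?thesis unfolding odd_coloring_def
  proof (intro conjI ballI impI)
    fix v assume v: "v \<in> verts G"
    show "c v \<in> {1..k}" using a v by blast
    assume "0 < out_degree G v"
    then have "neighborhood G v \<noteq> {}" by (auto simp: degree_eq_card_neighborhood)
    then obtain i where i: "i \<in> odd_colors c (neighborhood G v)" using a v by blast
    moreover have "neighborhood G v \<subseteq> verts G" by (auto simp: neighborhood_def)
    moreover have "c ` verts G \<subseteq> {1..k}" using a by blast
    ultimately have "i \<in> {1..k}" using odd_colors_subset[of c "neighborhood G v"] by blast
    then show "\<exists>i\<in>{1..k}. odd (card {u \<in> neighborhood G v. c u = i})"
      using i unfolding odd_colors_def by blast
  next
    fix u v assume "u \<in> verts G" "v \<in> verts G" "u \<rightarrow> v"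
    then have "v \<in> neighborhood G u" by (simp add: neighborhood_def)
    then show "c u \<noteq> c v" using a \<open>u \<in> verts G\<close> by metis
  qed
qed

text \<open>If \<open>q\<close> has m neighbors in \<open>S - Q\<close>, its degree in
  \<open>S\<close> is \<open>m + (card Q - 1)\<close>, so \<open>deg\<close> says
  \<open>2 * m + card Q + 1 \<le> k\<close>: removing two colors per outer neighbor leaves more than
  \<open>card Q\<close>.\<close>

lemma odd_coloring_on_extend_clique:
  assumes S: "S \<subseteq> verts G" and QS: "Q \<subseteq> S" and clique: "is_clique G Q" and two: "2 \<le> card Q"
    and deg: "\<And>q. q \<in> Q \<Longrightarrow> 2 * card (neighborhood G q \<inter> S) + 2 \<le> k + (card Q - 1)"
    and c: "odd_coloring_on G k (S - Q) c"
  shows "\<exists>d. odd_coloring_on G k S d"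
proof -
  let ?N = "neighborhood G"
  let ?O = "\<lambda>v. ?N v \<inter> (S - Q)"
  have finQ: "finite Q" using S QS by (meson finite_subset finite_verts)
  have QN: "Q - {q} \<subseteq> ?N q" if "q \<in> Q" for q
    using clique that by (auto simp: is_clique_def neighborhood_def)
  have NS: "?N q \<inter> S = ?O q \<union> (Q - {q})" if "q \<in> Q" for q
    using QN[OF that] QS that not_in_neighborhood_self by blast
  have finO: "finite (?O v)" for v using finite_neighborhood by simp
  have cardO: "card (?N q \<inter> S) = card (?O q) + (card Q - 1)" if "q \<in> Q" for q
  proof -
    have "card (?O q \<union> (Q - {q})) = card (?O q) + card (Q - {q})"
      using finO finQ by (intro card_Un_disjoint) auto
    then show ?thesis using NS[OF that] that by simp
  qed
  \<comment> \<open>\<open>f u\<close> is an odd color at \<open>u\<close> to be kept off the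
    neighbors of \<open>u\<close> in \<open>Q\<close>. If \<open>u\<close> has no neighbor in
    \<open>S - Q\<close>, its value is arbitrary and merely costs a color.\<close>
  define f where "f u = (SOME i. i \<in> odd_colors c (?O u))" for u
  have f: "f u \<in> odd_colors c (?O u)" if "u \<in> S - Q" "?O u \<noteq> {}" for u
  proof -
    have "odd_colors c (?O u) \<noteq> {}" using c that unfolding odd_coloring_on_def by blast
    then show ?thesis unfolding f_def by (rule some_in_eq[THEN iffD2])
  qed
  define L where "L q = {1..k} - (c ` ?O q \<union> f ` ?O q)" for q
  have L: "card Q < card (L q)" if q: "q \<in> Q" for q
  proof -
    have "card (c ` ?O q \<union> f ` ?O q) \<le> card (?O q) + card (?O q)"
      using card_Un_le[of "c ` ?O q" "f ` ?O q"] card_image_le[OF finO, of c q]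
        card_image_le[OF finO, of f q] by linarith
    moreover have "card {1..k} - card (c ` ?O q \<union> f ` ?O q) \<le> card (L q)"
      unfolding L_def using finO by (intro diff_card_le_card_Diff) auto
    ultimately show ?thesis using deg[OF q] cardO[OF q] two by simp
  qed
  have disj: "odd_colors c (?O q) \<inter> L q = {}" for q
    using odd_colors_subset[of c "?O q"] unfolding L_def by blast
  obtain e where e: "inj_on e Q" "\<And>q. q \<in> Q \<Longrightarrow> e q \<in> L q"
    "\<And>q. q \<in> Q \<Longrightarrow> e ` (Q - {q}) \<noteq> odd_colors c (?O q)"
  proof (rule injective_choice_avoiding[of Q L "\<lambda>q. odd_colors c (?O q)", OF finQ two L disj])
    fix e assume "inj_on e Q" "\<And>q. q \<in> Q \<Longrightarrow> e q \<in> L q"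
      "\<And>q. q \<in> Q \<Longrightarrow> e ` (Q - {q}) \<noteq> odd_colors c (?O q)"
    then show thesis by (rule that)
  qed
  define d where "d v = (if v \<in> Q then e v else c v)" for v
  have dO: "odd_colors d (?O v) = odd_colors c (?O v)" for v
    by (rule odd_colors_cong) (simp add: d_def)
  have dinj: "inj_on d A" if "A \<subseteq> Q" for A
    using e(1) that unfolding inj_on_def d_def by (meson subsetD)
  have "odd_coloring_on G k S d" unfolding odd_coloring_on_def
  proof (intro conjI ballI impI)
    show "d ` S \<subseteq> {1..k}"
      using c e(2) unfolding odd_coloring_on_def L_def d_def by auto
  next
    fix v u assume v: "v \<in> S" and u: "u \<in> ?N v \<inter> S"
    then have vu: "v \<in> ?N u" "u \<noteq> v" using neighborhood_sym not_in_neighborhood_self by blast+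
    consider "v \<in> Q" "u \<in> Q" | "v \<in> Q" "u \<notin> Q" | "v \<notin> Q" "u \<in> Q" | "v \<notin> Q" "u \<notin> Q" by blast
    then show "d u \<noteq> d v"
    proof cases
      case 1
      then show ?thesis using e(1) vu by (auto simp: d_def dest: inj_onD)
    next
      case 2
      then have "c u \<in> c ` ?O v" using u by blast
      then show ?thesis using e(2)[of v] 2 by (force simp: d_def L_def)
    next
      case 3
      then have "c v \<in> c ` ?O u" using vu v by blast
      then show ?thesis using e(2)[of u] 3 by (force simp: d_def L_def)
    next
      case 4
      then show ?thesis using c u v by (auto simp: d_def odd_coloring_on_def)
    qed
  next
    fix v assume v: "v \<in> S" and ne: "?N v \<inter> S \<noteq> {}"
    show "odd_colors d (?N v \<inter> S) \<noteq> {}"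
    proof (cases "v \<in> Q")
      case True
      \<comment> \<open>Every color on \<open>Q - {v}\<close> occurs once there. As this odd set
        differs from the one on the outer neighbors, their symmetric difference is nonempty.\<close>
      have "odd_colors d (Q - {v}) = d ` (Q - {v})" by (intro odd_colors_inj_on dinj) auto
      also have "\<dots> = e ` (Q - {v})" by (auto simp: d_def)
      finally have "odd_colors d (Q - {v}) \<noteq> odd_colors d (?O v)"
        using e(3)[OF True] dO by simp
      then show ?thesis
        unfolding NS[OF True] using odd_colors_Un[of "?O v" "Q - {v}" _ d] finO finQ by blast
    next
      case False
      have split: "?N v \<inter> S = ?O v \<union> (?N v \<inter> Q)" using QS by blast
      show ?thesis
      \<comment> \<open>If all neighbors of \<open>v\<close> in \<open>S\<close> lie in
        \<open>Q\<close>, their colors are distinct, hence all odd. Otherwise \<open>f v\<close>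
        stays odd, since the lists of the neighbors of \<open>v\<close> in \<open>Q\<close> omit
        it.\<close>
      proof (cases "?O v = {}")
        case True
        then have "odd_colors d (?N v \<inter> S) = d ` (?N v \<inter> S)"
          using split by (intro odd_colors_inj_on dinj) auto
        then show ?thesis using ne by simp
      next
        case nonempty: False
        have fv: "f v \<in> odd_colors c (?O v)" using f nonempty v False by blast
        have "f v \<notin> d ` (?N v \<inter> Q)"
        proof
          assume "f v \<in> d ` (?N v \<inter> Q)"
          then obtain q where q: "q \<in> ?N v" "q \<in> Q" "f v = e q" by (auto simp: d_def)
          then have "v \<in> ?O q" using neighborhood_sym v False by blast
          then show False using e(2)[OF q(2)] q(3) unfolding L_def by force
        qed
        then have "f v \<notin> odd_colors d (?N v \<inter> Q)" using odd_colors_subset by fast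
        then have "f v \<in> odd_colors d (?O v \<union> (?N v \<inter> Q))"
          using fv dO finO finQ by (subst odd_colors_Un) auto
        then show ?thesis using split by auto
      qed
    qed
  qed
  then show ?thesis by blast
qed

section \<open>Large cliques and the induction over vertex sets\<close>

text \<open>Pigeonhole: among at most \<open>l\<close> cliques covering the neighborhood, the one
  meeting \<open>S\<close> most contains at least a share of 1/l of it.\<close>

lemma large_clique_in_neighborhood:
  assumes "locally_clique_covered G q" and "q \<le> l" and "v \<in> verts G" and "neighborhood G v \<inter> S \<noteq> {}"
  obtains K where "is_clique G K" and "K \<subseteq> neighborhood G v \<inter> S"
    and "card (neighborhood G v \<inter> S) \<le> l * card K"
proof -
  let ?A = "neighborhood G v \<inter> S"
  obtain C where C: "finite C" "card C \<le> q" "\<forall>K\<in>C. is_clique G K" "neighborhood G v = \<Union>C"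
    using assms unfolding locally_clique_covered_def by meson
  have "C \<noteq> {}" using C assms by auto
  then have "Max ((\<lambda>K. card (K \<inter> S)) ` C) \<in> (\<lambda>K. card (K \<inter> S)) ` C"
    using C(1) by (intro Max_in) auto
  then obtain K where K: "K \<in> C" and Max: "Max ((\<lambda>K. card (K \<inter> S)) ` C) = card (K \<inter> S)"
    by blast
  have K_max: "card (K' \<inter> S) \<le> card (K \<inter> S)" if "K' \<in> C" for K'
    unfolding Max[symmetric] using C(1) that by (intro Max_ge) auto
  have "card ?A = card (\<Union>K'\<in>C. K' \<inter> S)" unfolding C(4) by (simp only: Int_Union2)
  also have "\<dots> \<le> (\<Sum>K'\<in>C. card (K' \<inter> S))" using C by (intro card_UN_le) simp
  also have "\<dots> \<le> (\<Sum>K'\<in>C. card (K \<inter> S))" by (intro sum_mono K_max)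
  also have "\<dots> \<le> l * card (K \<inter> S)" using C(2) assms(2) by simp
  finally have "card ?A \<le> l * card (K \<inter> S)" .
  moreover have "is_clique G (K \<inter> S)" using C(3) K by (auto simp: is_clique_def)
  moreover have "K \<inter> S \<subseteq> ?A" using C(4) K by auto
  ultimately show ?thesis using that by blast
qed

text \<open>\<open>D\<close> and \<open>k\<close> stay fixed while \<open>S\<close> shrinks, since
  degrees inside a subset only drop.\<close>

lemma odd_coloring_on_exists:
  assumes l: "0 < l" and cov: "locally_clique_covered G q" "q \<le> l"
    and S: "S \<subseteq> verts G" and deg: "\<And>v. v \<in> S \<Longrightarrow> card (neighborhood G v \<inter> S) \<le> D"
    and k: "(2 * real l - 1) / real l * real D + 1 < real k"
  shows "\<exists>c. odd_coloring_on G k S c"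
proof -
  have "finite S" using S finite_verts finite_subset by blast
  then show ?thesis using S deg
  proof (induction S rule: finite_psubset_induct)
    case (psubset S)
    let ?N = "neighborhood G"
    have coef: "0 \<le> (2 * real l - 1) / real l" using l by simp
    show ?case
    proof (cases "\<forall>v\<in>S. ?N v \<inter> S = {}")
      case True
      have "0 \<le> (2 * real l - 1) / real l * real D" using coef by (rule mult_nonneg_nonneg) simp
      then have "1 \<le> k" using k by simp
      then have "odd_coloring_on G k S (\<lambda>_. 1)" using True by (auto simp: odd_coloring_on_def)
      then show ?thesis by blast
    next
      case False
      then have "S \<noteq> {}" by auto
      \<comment> \<open>Maximality of the degree of \<open>v\<close> within \<open>S\<close> lets
        the estimate at \<open>v\<close> serve for every vertex of \<open>?Q\<close>.\<close>
      then obtain v where v: "v \<in> S" "\<forall>u\<in>S. card (?N u \<inter> S) \<le> card (?N v \<inter> S)"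
        using obtains_MAX[of S "\<lambda>v. card (?N v \<inter> S)"] psubset.hyps
        by (metis Max_ge finite_imageI imageI)
      obtain u where "u \<in> S" "?N u \<inter> S \<noteq> {}" using False by blast
      then have "0 < card (?N v \<inter> S)"
        using v(2) finite_neighborhood by (metis card_gt_0_iff finite_Int gr0I leD)
      then have ne: "?N v \<inter> S \<noteq> {}" by auto
      have vG: "v \<in> verts G" using v psubset.prems by blast
      obtain K where K: "is_clique G K" "K \<subseteq> ?N v \<inter> S" "card (?N v \<inter> S) \<le> l * card K"
        using large_clique_in_neighborhood[OF cov vG ne] by blast
      let ?Q = "insert v K"
      have finK: "finite K" using K(2) finite_neighborhood by (meson finite_Int finite_subset)
      have "v \<notin> K" using K(2) not_in_neighborhood_self by blast
      then have cQ: "card ?Q = card K + 1" using finK by simp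
      have "0 < card K" using K(3) \<open>0 < card (?N v \<inter> S)\<close> by (metis gr0I leD mult_0_right)
      have QS: "?Q \<subseteq> S" using v K by blast
      have "is_clique G ?Q"
        unfolding is_clique_def
      proof (intro conjI ballI impI)
        show "?Q \<subseteq> verts G" using QS psubset.prems(1) by (rule subset_trans)
        have *: "u \<in> ?N v" "v \<in> ?N u" if "u \<in> K" for u
          using K(2) that neighborhood_sym by blast+
        fix a b assume "a \<in> ?Q" "b \<in> ?Q" "a \<noteq> b"
        then show "a \<rightarrow> b"
          using K(1) * unfolding is_clique_def neighborhood_def by blast
      qed
      moreover have "2 \<le> card ?Q" using cQ \<open>0 < card K\<close> by simp
      moreover have "2 * card (?N w \<inter> S) + 2 \<le> k + (card ?Q - 1)" if "w \<in> ?Q" for w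
      proof -
        let ?d = "card (?N v \<inter> S)"
        have "(2 * real l - 1) / real l * real ?d \<le> (2 * real l - 1) / real l * real D"
          using psubset.prems(2)[OF v(1)] coef by (intro mult_left_mono) auto
        \<comment> \<open>The coefficient is 2 - 1/l: the saving \<open>real ?d / real l\<close> is
          at most the size of the clique \<open>K\<close>.\<close>
        moreover have "(2 * real l - 1) / real l * real ?d = 2 * real ?d - real ?d / real l"
          using l by (simp add: field_simps)
        moreover have "real ?d \<le> real l * real (card K)"
          using K(3) by (metis of_nat_le_iff of_nat_mult)
        then have "real ?d / real l \<le> real (card K)" using l by (simp add: field_simps)
        ultimately have "2 * real ?d + 1 < real k + real (card K)" using k by linarith
        \<comment> \<open>Integrality turns the strict real inequality into a gain of one.\<close>
        then have "2 * ?d + 2 \<le> k + card K" by linarith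
        moreover have "card (?N w \<inter> S) \<le> ?d" using v(2) QS that by blast
        ultimately show ?thesis using cQ by simp
      qed
      moreover have "\<exists>c. odd_coloring_on G k (S - ?Q) c"
      proof (rule psubset.IH)
        show "S - ?Q \<subset> S" using v by blast
        show "S - ?Q \<subseteq> verts G" using psubset.prems by blast
        fix w assume "w \<in> S - ?Q"
        then have "card (?N w \<inter> S) \<le> D" using psubset.prems by blast
        moreover have "card (?N w \<inter> (S - ?Q)) \<le> card (?N w \<inter> S)"
          using finite_neighborhood by (intro card_mono) auto
        ultimately show "card (?N w \<inter> (S - ?Q)) \<le> D" by linarith
      qed
      ultimately show ?thesis
        using odd_coloring_on_extend_clique[OF psubset.prems(1) QS] by blast
    qed
  qed
qed

end

theorem theorem1p6:
  fixes G :: "('a, 'b) pre_digraph" and l :: nat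
  assumes "l > 0" and "graph G" and "lcc G \<le> l"
  shows "real (odd_chromatic_number G) \<le> (2 * real l - 1) / real l * real (max_degree G) + 2"
proof -
  interpret graph G by fact
  let ?x = "(2 * real l - 1) / real l * real (max_degree G)"
  \<comment> \<open>The largest integer not above \<open>?x + 2\<close>; it automatically exceeds
    \<open>?x + 1\<close>, as the induction requires.\<close>
  define k where "k = nat \<lfloor>?x\<rfloor> + 2"
  have "0 \<le> ?x" using assms(1) by simp
  then have k: "?x + 1 < real k" "real k \<le> ?x + 2" unfolding k_def by linarith+
  have "card (neighborhood G v \<inter> verts G) \<le> max_degree G" if "v \<in> verts G" for v
  proof -
    have "neighborhood G v \<inter> verts G = neighborhood G v" by (auto simp: neighborhood_def)
    then show ?thesis
      using that unfolding max_degree_def degree_eq_card_neighborhood by (intro Max_ge) auto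
  qed
  then obtain c where "odd_coloring_on G k (verts G) c"
    using odd_coloring_on_exists[OF assms(1) locally_clique_covered_lcc assms(3) subset_refl _ k(1)]
    by blast
  then have "odd_chromatic_number G \<le> k"
    unfolding odd_chromatic_number_def
    using odd_coloring_if_odd_coloring_on by (intro Least_le) blast
  then show ?thesis using k(2) by linarith
qed

end
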